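(* Let $(P,\circ_\lambda,[\cdot_\lambda\cdot])$ be a noncommutative Poisson conformal algebra. If $(\varpi,\omega)$ generates a linear deformation of $P$, then $\omega+\varpi$ (with $\omega\in C^{2,0}(P,P)$ and $\varpi\in C^{0,2}(P,P)$) is a $2$-cocycle for $P$ with coefficients in $P$, i.e. $\omega+\varpi\in C^2_{\mathrm{FGV}}(P,P)$ and $\mathrm d_{\mathrm{FGV}}(\omega+\varpi)=0$.
   Context: All vector spaces are over $\mathbb{C}$. In expressions such as $b_{-\lambda-\partial}a$ the variable is replaced by $-\lambda-\partial$ with $\partial$ moved to the left, acting on the coefficients. A conformal algebra is a $\mathbb{C}[\partial]$-module $A$ with a bilinear map $A\times A\to A[\lambda]$, $(a,b)\mapsto a_\lambda b$, with $(\partial a)_\lambda b=-\lambda a_\lambda b$, $a_\lambda(\partial b)=(\partial+\lambda)(a_\lambda b)$. A noncommutative Poisson conformal algebra $(P,\circ_\lambda,[\cdot_\lambda\cdot])$ is a $\mathbb{C}[\partial]$-module such that both operations are conformal algebra structures, $a\circ_\lambda(b\circ_\mu c)=(a\circ_\lambda b)\circ_{\lambda+\mu}c$, $[a_\lambda b]=-[b_{-\lambda-\partial}a]$, $[a_\lambda[b_\mu c]]=[[a_\lambda b]_{\lambda+\mu}c]+[b_\mu[a_\lambda c]]$, and $[a_\lambda(b\circ_\mu c)]=[a_\lambda b]\circ_{\lambda+\mu}c+b\circ_\mu[a_\lambda c]$. Linear deformations. Let $\varpi,\omega:P\otimes P\to P[\lambda]$ be linear maps, written $\{a_\lambda b\}_\varpi$,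 $\{a_\lambda b\}_\omega$, and put $a\circ_{t\lambda}b=a\circ_\lambda b+t\{a_\lambda b\}_\varpi$, $[a_\lambda b]_t=[a_\lambda b]+t\{a_\lambda b\}_\omega$. If $(P,\circ_{t\lambda},[\cdot_\lambda\cdot]_t)$ (with the same $\partial$) is a noncommutative Poisson conformal algebra for all $t\in\mathbb{R}$, then $(\varpi,\omega)$ is said to generate a linear deformation of $P$. Cochains in degrees $2$ and $3$ with coefficients in $P$ itself (viewed as a module over $P$ by left and right $\lambda$-multiplication and the $\lambda$-bracket). A $k$-$\lambda$-bracket on $P$ is a linear map $\gamma:P^{\otimes k}\to\mathbb{C}[\lambda_1,\dots,\lambda_{k-1}]\otimes P$, $a_1\otimes\cdots\otimes a_k\mapsto\{a_{1\,\lambda_1}\cdots a_{k-1\,\lambda_{k-1}}a_k\}_\gamma$, such that replacing $a_i$ by $\partial a_i$ multiplies by $-\lambda_i$ for $i\le k-1$ and replacing $a_k$ by $\partial a_k$ multiplies by $\lambda_1+\cdots+\lambda_{k-1}+\partial$. $C^{2,0}(P,P)$ is the space of $2$-$\lambda$-brackets $\gamma$ with $\{a_\lambda b\}_\gamma=-\{b_{-\lambda-\partial}a\}_\gamma$; $C^{0,2}(P,P)$ the space of all $2$-$\lambda$-brackets; $C^{3,0}(P,P)$ the space of $3$-$\lambda$-brackets that are skew-symmetric under simultaneous permutation of arguments and variables, where the third variable $\lambda_3$ is read as $-\lambda_1-\lambda_2-\partial$ with $\partial$ moved to the left; $C^{1,2}(P,P)$ and $C^{0,3}(P,P)$ are both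 the space of all $3$-$\lambda$-brackets. Then $C^2_{\mathrm{FGV}}(P,P)=C^{2,0}\oplus C^{0,2}$, $C^3_{\mathrm{FGV}}(P,P)=C^{3,0}\oplus C^{1,2}\oplus C^{0,3}$, and $\mathrm d_{\mathrm{FGV}}(\omega+\varpi)$ has components $\mathrm d_{\mathrm{CE}}\omega\in C^{3,0}$, $\mathrm d^{0,2}_{\mathrm{CE}}\varpi-\mathrm d^{1,1}_{\mathrm H}\omega\in C^{1,2}$, $\mathrm d^{0,2}_{\mathrm H}\varpi\in C^{0,3}$, where $$\{a_\lambda b_\mu c\}_{\mathrm d_{\mathrm{CE}}\omega}=[a_\lambda\{b_\mu c\}_\omega]-[b_\mu\{a_\lambda c\}_\omega]+\{c_{-\lambda-\mu-\partial}[a_\lambda b]\}_\omega+[c_{-\lambda-\mu-\partial}\{a_\lambda b\}_\omega]-\{b_\mu[a_\lambda c]\}_\omega+\{a_\lambda[b_\mu c]\}_\omega,$$ $$\{a_\lambda b_\mu c\}_{\mathrm d^{0,2}_{\mathrm{CE}}\varpi}=[a_\lambda\{b_\mu c\}_\varpi]-\{[a_\lambda b]_{\lambda+\mu}c\}_\varpi-\{b_\mu[a_\lambda c]\}_\varpi,$$ $$\{a_\lambda b_\mu c\}_{\mathrm d^{1,1}_{\mathrm H}\omega}=b\circ_\mu\{a_\lambda c\}_\omega-\{a_\lambda(b\circ_\mu c)\}_\omega+\{a_\lambda b\}_\omega\circ_{\lambda+\mu}c,$$ $$\{a_\lambda b_\mu c\}_{\mathrm d^{0,2}_{\mathrm H}\varpi}=a\circ_\lambda\{b_\mu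 c\}_\varpi-\{(a\circ_\lambda b)_{\lambda+\mu}c\}_\varpi+\{a_\lambda(b\circ_\mu c)\}_\varpi-\{a_\lambda b\}_\varpi\circ_{\lambda+\mu}c.$$ *)

theory Defs
  imports Complex_Main "HOL-Computational_Algebra.Polynomial"
begin

(* P is the type 'a, a complex vector space via scale; its C[d]-module structure is the linear
   endomorphism D. P[lambda] is 'a poly. P[lambda, mu] is 'a poly poly, where lambda is the
   inner and mu the outer variable. *)

type_synonym 'a bracket2 = "'a \<Rightarrow> 'a \<Rightarrow> 'a poly"
type_synonym 'a bracket3 = "'a \<Rightarrow> 'a \<Rightarrow> 'a \<Rightarrow> 'a poly poly"

(* For p = sum of x_i nu^i in P[nu], this is the sum of T^i (f x_i): the operator T is substituted
   for nu. If T involves D then D acts on the coefficients, i.e. it is moved to the left. *)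
definition subst_var :: "('m \<Rightarrow> 'm) \<Rightarrow> ('a \<Rightarrow> 'm) \<Rightarrow> 'a::zero poly \<Rightarrow> 'm::comm_monoid_add"
  where "subst_var T f p = (\<Sum>i\<le>degree p. (T ^^ i) (f (coeff p i)))"

definition cst2 :: "'a::zero \<Rightarrow> 'a poly poly"
  where "cst2 x = [:[:x:]:]"

definition lam :: "'a::zero poly poly \<Rightarrow> 'a poly poly"
  where "lam = map_poly (pCons 0)"

definition mu :: "'a::zero poly poly \<Rightarrow> 'a poly poly"
  where "mu = pCons 0"

definition lam_mu :: "'a::comm_monoid_add poly poly \<Rightarrow> 'a poly poly"
  where "lam_mu q = lam q + mu q"

(* -lambda - mu - d *)
definition neg_lam_mu_d :: "('a \<Rightarrow> 'a) \<Rightarrow> 'a::ab_group_add poly poly \<Rightarrow> 'a poly poly"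
  where "neg_lam_mu_d D q = - lam q - mu q - map_poly (map_poly D) q"

(* b_{-lambda-d} a *)
definition opposite :: "('a \<Rightarrow> 'a) \<Rightarrow> 'a::ab_group_add bracket2 \<Rightarrow> 'a bracket2"
  where "opposite D f a b =
    subst_var (\<lambda>q. - pCons 0 q - map_poly D q) (\<lambda>x. [:x:]) (f b a)"

(* right_comp f a T (g b c) S is a f_T (b g_S c);
   left_comp f (g a b) S T c is (a g_S b) f_T c. *)
definition right_comp :: "'a::comm_monoid_add bracket2 \<Rightarrow> 'a \<Rightarrow> ('a poly poly \<Rightarrow> 'a poly poly)
    \<Rightarrow> 'a poly \<Rightarrow> ('a poly poly \<Rightarrow> 'a poly poly) \<Rightarrow> 'a poly poly"
  where "right_comp f a T p S = subst_var S (\<lambda>x. subst_var T cst2 (f a x)) p"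

definition left_comp :: "'a::comm_monoid_add bracket2 \<Rightarrow> 'a poly \<Rightarrow> ('a poly poly \<Rightarrow> 'a poly poly)
    \<Rightarrow> ('a poly poly \<Rightarrow> 'a poly poly) \<Rightarrow> 'a \<Rightarrow> 'a poly poly"
  where "left_comp f p S T c = subst_var S (\<lambda>x. subst_var T cst2 (f x c)) p"

definition bilinear_bracket ::
    "(complex \<Rightarrow> 'a \<Rightarrow> 'a) \<Rightarrow> 'a::ab_group_add bracket2 \<Rightarrow> bool"
  where "bilinear_bracket scale f \<longleftrightarrow>
    (\<forall>b. Vector_Spaces.linear scale (\<lambda>r. map_poly (scale r)) (\<lambda>a. f a b)) \<and>
    (\<forall>a. Vector_Spaces.linear scale (\<lambda>r. map_poly (scale r)) (\<lambda>b. f a b))"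

definition lambda_bracket2 ::
    "(complex \<Rightarrow> 'a \<Rightarrow> 'a) \<Rightarrow> ('a \<Rightarrow> 'a) \<Rightarrow> 'a::ab_group_add bracket2 \<Rightarrow> bool"
  where "lambda_bracket2 scale D f \<longleftrightarrow> bilinear_bracket scale f \<and>
    (\<forall>a b. f (D a) b = - pCons 0 (f a b)) \<and>
    (\<forall>a b. f a (D b) = pCons 0 (f a b) + map_poly D (f a b))"

locale conformal_algebra = vector_space scale
  for scale :: "complex \<Rightarrow> 'a::ab_group_add \<Rightarrow> 'a" +
  fixes D :: "'a \<Rightarrow> 'a" and f :: "'a bracket2"
  assumes D_linear: "Vector_Spaces.linear scale scale D"
    and bracket: "lambda_bracket2 scale D f"

locale nc_poisson_conformal_algebra =
  circ: conformal_algebra scale D circ + brac: conformal_algebra scale D brac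
  for scale :: "complex \<Rightarrow> 'a::ab_group_add \<Rightarrow> 'a" and D :: "'a \<Rightarrow> 'a"
    and circ :: "'a bracket2" and brac :: "'a bracket2" +
  assumes assoc:
      "right_comp circ a lam (circ b c) mu = left_comp circ (circ a b) lam lam_mu c"
    and skew: "brac a b = - opposite D brac a b"
    and jacobi: "right_comp brac a lam (brac b c) mu =
      left_comp brac (brac a b) lam lam_mu c + right_comp brac b mu (brac a c) lam"
    and leibniz: "right_comp brac a lam (circ b c) mu =
      left_comp circ (brac a b) lam lam_mu c + right_comp circ b mu (brac a c) lam"

definition deformed_bracket :: "(complex \<Rightarrow> 'a \<Rightarrow> 'a) \<Rightarrow> real \<Rightarrow> 'a bracket2 \<Rightarrow>
    'a bracket2 \<Rightarrow> 'a::ab_group_add bracket2"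
  where "deformed_bracket scale t f g a b = f a b + map_poly (scale (of_real t)) (g a b)"

definition generates_linear_deformation :: "(complex \<Rightarrow> 'a \<Rightarrow> 'a) \<Rightarrow> ('a \<Rightarrow> 'a) \<Rightarrow>
    'a bracket2 \<Rightarrow> 'a bracket2 \<Rightarrow> 'a bracket2 \<Rightarrow> 'a::ab_group_add bracket2 \<Rightarrow> bool"
  where "generates_linear_deformation scale D circ brac varpi omega \<longleftrightarrow>
    bilinear_bracket scale varpi \<and> bilinear_bracket scale omega \<and>
    (\<forall>t::real. nc_poisson_conformal_algebra scale D
      (deformed_bracket scale t circ varpi) (deformed_bracket scale t brac omega))"

definition C20 :: "(complex \<Rightarrow> 'a \<Rightarrow> 'a) \<Rightarrow> ('a \<Rightarrow> 'a) \<Rightarrow> 'a::ab_group_add bracket2 set"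
  where "C20 scale D =
    {f. lambda_bracket2 scale D f \<and> (\<forall>a b. f a b = - opposite D f a b)}"

definition C02 :: "(complex \<Rightarrow> 'a \<Rightarrow> 'a) \<Rightarrow> ('a \<Rightarrow> 'a) \<Rightarrow> 'a::ab_group_add bracket2 set"
  where "C02 scale D = {f. lambda_bracket2 scale D f}"

definition C2_FGV :: "(complex \<Rightarrow> 'a \<Rightarrow> 'a) \<Rightarrow> ('a \<Rightarrow> 'a) \<Rightarrow>
    ('a::ab_group_add bracket2 \<times> 'a bracket2) set"
  where "C2_FGV scale D = C20 scale D \<times> C02 scale D"

definition d_CE :: "('a \<Rightarrow> 'a) \<Rightarrow> 'a bracket2 \<Rightarrow> 'a bracket2 \<Rightarrow> 'a::ab_group_add bracket3"
  where "d_CE D brac omega a b c =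
      right_comp brac a lam (omega b c) mu
    - right_comp brac b mu (omega a c) lam
    + right_comp omega c (neg_lam_mu_d D) (brac a b) lam
    + right_comp brac c (neg_lam_mu_d D) (omega a b) lam
    - right_comp omega b mu (brac a c) lam
    + right_comp omega a lam (brac b c) mu"

definition d02_CE :: "'a bracket2 \<Rightarrow> 'a bracket2 \<Rightarrow> 'a::ab_group_add bracket3"
  where "d02_CE brac varpi a b c =
      right_comp brac a lam (varpi b c) mu
    - left_comp varpi (brac a b) lam lam_mu c
    - right_comp varpi b mu (brac a c) lam"

definition d11_H :: "'a bracket2 \<Rightarrow> 'a bracket2 \<Rightarrow> 'a::ab_group_add bracket3"
  where "d11_H circ omega a b c =
      right_comp circ b mu (omega a c) lam
    - right_comp omega a lam (circ b c) mu
    + left_comp circ (omega a b) lam lam_mu c"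

definition d02_H :: "'a bracket2 \<Rightarrow> 'a bracket2 \<Rightarrow> 'a::ab_group_add bracket3"
  where "d02_H circ varpi a b c =
      right_comp circ a lam (varpi b c) mu
    - left_comp varpi (circ a b) lam lam_mu c
    + right_comp varpi a lam (circ b c) mu
    - left_comp circ (varpi a b) lam lam_mu c"

(* The components lie in C^{3,0}, C^{1,2} and C^{0,3}, in this order. *)
definition d_FGV :: "('a \<Rightarrow> 'a) \<Rightarrow> 'a bracket2 \<Rightarrow> 'a bracket2 \<Rightarrow>
    'a bracket2 \<times> 'a bracket2 \<Rightarrow> 'a::ab_group_add bracket3 \<times> 'a bracket3 \<times> 'a bracket3"
  where "d_FGV D circ brac = (\<lambda>(omega, varpi).
    (d_CE D brac omega,
     \<lambda>a b c. d02_CE brac varpi a b c - d11_H circ omega a b c,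
     d02_H circ varpi))"

definition is_2_cocycle_FGV :: "(complex \<Rightarrow> 'a \<Rightarrow> 'a) \<Rightarrow> ('a \<Rightarrow> 'a) \<Rightarrow> 'a bracket2 \<Rightarrow>
    'a bracket2 \<Rightarrow> 'a bracket2 \<times> 'a::ab_group_add bracket2 \<Rightarrow> bool"
  where "is_2_cocycle_FGV scale D circ brac \<gamma> \<longleftrightarrow>
    \<gamma> \<in> C2_FGV scale D \<and>
    d_FGV D circ brac \<gamma> = (\<lambda>_ _ _. 0, \<lambda>_ _ _. 0, \<lambda>_ _ _. 0)"

end

theory Submission
  imports Defs
begin

text \<open>
  Every axiom of a noncommutative Poisson conformal algebra that involves two products is an
  identity \<open>Q(\<beta>, \<beta>) = 0\<close>, where \<open>Q\<close> is additive in each of its two arguments and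
  \<open>\<beta>\<close> stands for the pair of brackets. Along the deformation \<open>\<beta> + t \<gamma>\<close> it is therefore a
  quadratic polynomial in \<open>t\<close>, and the coefficient of \<open>t\<close>, which is
  \<open>Q(\<beta>, \<gamma>) + Q(\<gamma>, \<beta>)\<close>, has to vanish. These linear coefficients of associativity, of the
  Leibniz rule and of the Jacobi identity are the three components of the differential.

  The two values \<open>t = 1\<close> and \<open>t = -1\<close> already isolate the linear coefficient: by
  polarization, the difference of the two identities is twice the cross term
  (\<open>right_comp_polarization\<close>, \<open>left_comp_polarization\<close>), and a complex vector space has no
  2-torsion.

  For associativity and the Leibniz rule the cross term is the cocycle expression as it stands. In
  the Chevalley-Eilenberg differential, however, the terms \<open>[[a b] c]\<close> of the Jacobi identity are
  written with \<open>c\<close> in front. For a skew-symmetric bracket the two forms are opposite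
  (\<open>left_comp_eq_right_comp_if_skew\<close>); this holds because substituting \<open>\<lambda> + \<mu>\<close> for the variable
  of \<open>c\<^bsub>-\<nu>-\<partial>\<^esub>x\<close> amounts to substituting \<open>-\<lambda> - \<mu> - \<partial>\<close> for the variable of \<open>c\<^bsub>\<nu>\<^esub>x\<close>.

  The conditions on one bracket, sesquilinearity and skew-symmetry, are additive in the
  bracket, so they pass to the difference of the deformed bracket at \<open>t = 1\<close> and the
  original one.
\<close>

section \<open>Additive operators on polynomials\<close>

lemma additive_funpow:
  fixes T :: "'m::ab_group_add \<Rightarrow> 'm"
  assumes "additive T"
  shows "additive (T ^^ i)"
proof
  show "(T ^^ i) (x + y) = (T ^^ i) x + (T ^^ i) y" for x y
    by (induction i) (simp_all add: additive.add[OF assms])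
qed

lemma additive_map_poly:
  fixes f :: "'a::ab_group_add \<Rightarrow> 'b::ab_group_add"
  assumes "additive f"
  shows "additive (map_poly f)"
proof
  show "map_poly f (p + q) = map_poly f p + map_poly f q" for p q
    by (rule poly_eqI)
      (simp add: coeff_map_poly additive.zero[OF assms] additive.add[OF assms])
qed

lemma additive_pCons_0: "additive (pCons (0 :: 'a::ab_group_add))"
  by unfold_locales simp

lemma additive_cst2: "additive (cst2 :: 'a::ab_group_add \<Rightarrow> 'a poly poly)"
  by unfold_locales (simp add: cst2_def)

lemma additive_lam: "additive (lam :: 'a::ab_group_add poly poly \<Rightarrow> 'a poly poly)"
  unfolding lam_def by (intro additive_map_poly additive_pCons_0)

lemma additive_mu: "additive (mu :: 'a::ab_group_add poly poly \<Rightarrow> 'a poly poly)"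
  unfolding mu_def by (rule additive_pCons_0)

lemma additive_lam_mu: "additive (lam_mu :: 'a::ab_group_add poly poly \<Rightarrow> 'a poly poly)"
  by unfold_locales
    (simp add: lam_mu_def additive.add[OF additive_lam] additive.add[OF additive_mu])

lemma additive_neg_var_d:
  fixes D :: "'a::ab_group_add \<Rightarrow> 'a"
  assumes "additive D"
  shows "additive (\<lambda>q. - pCons 0 q - map_poly D q)"
proof
  show "- pCons 0 (x + y) - map_poly D (x + y)
      = (- pCons 0 x - map_poly D x) + (- pCons 0 y - map_poly D y)" for x y
    using additive.add[OF additive_pCons_0, of x y]
    by (simp add: additive.add[OF additive_map_poly[OF assms]])
qed

lemmas additive_variables = additive_lam additive_mu additive_lam_mu

section \<open>Substitution of an operator for the variable\<close>

lemma subst_var_eq_sum: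
  fixes T :: "'m::ab_group_add \<Rightarrow> 'm" and f :: "'a::ab_group_add \<Rightarrow> 'm"
  assumes T: "additive T" and f: "additive f" and "degree p \<le> n"
  shows "subst_var T f p = (\<Sum>i\<le>n. (T ^^ i) (f (coeff p i)))"
  unfolding subst_var_def
  by (rule sum.mono_neutral_left)
    (use assms(3) in \<open>auto simp: coeff_eq_0 additive.zero[OF f]
      additive.zero[OF additive_funpow[OF T]]\<close>)

lemma additive_subst_var:
  fixes T :: "'m::ab_group_add \<Rightarrow> 'm" and f :: "'a::ab_group_add \<Rightarrow> 'm"
  assumes T: "additive T" and f: "additive f"
  shows "additive (subst_var T f)"
proof
  fix p q :: "'a poly"
  define n where "n = max (degree p) (degree q)"
  have "degree p \<le> n" "degree q \<le> n" "degree (p + q) \<le> n"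
    by (simp_all add: n_def degree_add_le_max)
  then show "subst_var T f (p + q) = subst_var T f p + subst_var T f q"
    by (simp add: subst_var_eq_sum[OF T f] additive.add[OF f]
      additive.add[OF additive_funpow[OF T]] sum.distrib)
qed

lemma subst_var_pCons:
  fixes T :: "'m::ab_group_add \<Rightarrow> 'm" and f :: "'a::ab_group_add \<Rightarrow> 'm"
  assumes T: "additive T" and f: "additive f"
  shows "subst_var T f (pCons x p) = f x + T (subst_var T f p)"
proof -
  have "subst_var T f (pCons x p)
      = (\<Sum>i\<le>Suc (degree p). (T ^^ i) (f (coeff (pCons x p) i)))"
    by (rule subst_var_eq_sum[OF T f degree_pCons_le])
  also have "\<dots> = f x + (\<Sum>i\<le>degree p. T ((T ^^ i) (f (coeff p i))))"
    unfolding sum.atMost_Suc_shift by simp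
  finally show ?thesis
    by (simp add: subst_var_def additive.sum[OF T])
qed

lemma subst_var_add_fun:
  fixes T :: "'m::ab_group_add \<Rightarrow> 'm"
  assumes "additive T"
  shows "subst_var T (\<lambda>x. f x + g x) p = subst_var T f p + subst_var T g p"
  by (simp add: subst_var_def additive.add[OF additive_funpow[OF assms]] sum.distrib)

lemma subst_var_diff_fun:
  fixes T :: "'m::ab_group_add \<Rightarrow> 'm"
  assumes "additive T"
  shows "subst_var T (\<lambda>x. f x - g x) p = subst_var T f p - subst_var T g p"
  by (simp add: subst_var_def additive.diff[OF additive_funpow[OF assms]] sum_subtractf)

text \<open>A map that intertwines two operators intertwines all their powers, hence the
  substitutions of these operators. This is how successive substitutions are composed.\<close>

lemma subst_var_intertwine:
  fixes T :: "'m::ab_group_add \<Rightarrow> 'm" and T' :: "'n::ab_group_add \<Rightarrow> 'n"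
  assumes "additive E" and "\<And>q. E (T q) = T' (E q)"
  shows "E (subst_var T f p) = subst_var T' (\<lambda>x. E (f x)) p"
proof -
  have "E ((T ^^ i) q) = (T' ^^ i) (E q)" for i q
    by (induction i) (simp_all add: assms(2))
  then show ?thesis
    by (simp add: subst_var_def additive.sum[OF assms(1)])
qed

section \<open>Polarization of iterated brackets\<close>

text \<open>An iterated bracket is biadditive in the outer bracket and the inner value, so in the
  difference of its values at \<open>(f + g, p + q)\<close> and \<open>(f - g, p - q)\<close> the terms \<open>(f, p)\<close> and
  \<open>(g, q)\<close> cancel and the mixed ones double. They are written as a sum of two equal terms since
  the coefficients form only an abelian group here.\<close>

lemma right_comp_polarization:
  fixes f g :: "'a::ab_group_add bracket2"
  assumes T: "additive T" and S: "additive S" and f: "additive (f a)" and g: "additive (g a)"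
  shows "right_comp (\<lambda>x y. f x y + g x y) a T (p + q) S
      - right_comp (\<lambda>x y. f x y - g x y) a T (p - q) S
    = (right_comp f a T q S + right_comp g a T p S)
      + (right_comp f a T q S + right_comp g a T p S)"
proof -
  note sub = additive_subst_var[OF T additive_cst2]
  have F: "additive (\<lambda>x. subst_var T cst2 (f a x))" and G: "additive (\<lambda>x. subst_var T cst2 (g a x))"
    by unfold_locales (simp_all add: additive.add[OF f] additive.add[OF g] additive.add[OF sub])
  show ?thesis
    by (simp add: right_comp_def additive.add[OF sub] additive.diff[OF sub]
        subst_var_add_fun[OF S] subst_var_diff_fun[OF S]
        additive.add[OF additive_subst_var[OF S F]] additive.add[OF additive_subst_var[OF S G]]
        additive.diff[OF additive_subst_var[OF S F]] additive.diff[OF additive_subst_var[OF S G]])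
qed

lemma left_comp_polarization:
  fixes f g :: "'a::ab_group_add bracket2"
  assumes T: "additive T" and S: "additive S"
    and f: "additive (\<lambda>x. f x c)" and g: "additive (\<lambda>x. g x c)"
  shows "left_comp (\<lambda>x y. f x y + g x y) (p + q) S T c
      - left_comp (\<lambda>x y. f x y - g x y) (p - q) S T c
    = (left_comp f q S T c + left_comp g p S T c)
      + (left_comp f q S T c + left_comp g p S T c)"
proof -
  \<comment> \<open>The two compositions feed the inner value into different arguments of the outer
    bracket, so exchanging these arguments turns one into the other.\<close>
  have "left_comp h r S T c = right_comp (\<lambda>x y. h y x) c T r S" for h :: "'a bracket2" and r
    by (simp add: left_comp_def right_comp_def)
  then show ?thesis
    using right_comp_polarization[OF T S, of "\<lambda>x y. f y x" c "\<lambda>x y. g y x" p q] f g by simp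
qed

section \<open>Skew-symmetric brackets\<close>

lemma opposite_add:
  assumes "additive D"
  shows "opposite D (\<lambda>x y. f x y + g x y) a b = opposite D f a b + opposite D g a b"
proof -
  have "additive (\<lambda>x::'a. [:x:])"
    by unfold_locales simp
  from additive.add[OF additive_subst_var[OF additive_neg_var_d[OF assms] this]]
  show ?thesis
    unfolding opposite_def by this
qed

lemma map_poly_map_poly_lam:
  assumes "additive D"
  shows "map_poly (map_poly D) (lam q) = lam (map_poly (map_poly D) q)"
  by (rule poly_eqI)
    (simp add: lam_def coeff_map_poly additive.zero[OF assms] map_poly_pCons)

lemma map_poly_map_poly_mu:
  assumes "additive D"
  shows "map_poly (map_poly D) (mu q) = mu (map_poly (map_poly D) q)"
  by (simp add: mu_def map_poly_pCons)

lemma map_poly_map_poly_lam_mu: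
  assumes "additive D"
  shows "map_poly (map_poly D) (lam_mu q) = lam_mu (map_poly (map_poly D) q)"
  by (simp add: lam_mu_def map_poly_map_poly_lam map_poly_map_poly_mu
      additive.add[OF additive_map_poly[OF additive_map_poly]] assms)

lemma subst_var_lam_mu_map_poly:
  fixes D :: "'a::ab_group_add \<Rightarrow> 'a"
  assumes D: "additive D"
  shows "subst_var lam_mu cst2 (map_poly D p) = map_poly (map_poly D) (subst_var lam_mu cst2 p)"
proof (induction p)
  case 0
  then show ?case
    by (simp add: additive.zero[OF additive_subst_var[OF additive_lam_mu additive_cst2]])
next
  case (pCons x p)
  have "map_poly (map_poly D) (cst2 x) = cst2 (D x)"
    by (simp add: cst2_def map_poly_pCons additive.zero[OF D])
  with pCons show ?case
    by (simp add: map_poly_pCons additive.zero[OF D]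
        subst_var_pCons[OF additive_lam_mu additive_cst2]
        map_poly_map_poly_lam_mu[OF D]
        additive.add[OF additive_map_poly[OF additive_map_poly[OF D]]])
qed

text \<open>Replacing \<open>\<nu>\<close> by \<open>-\<nu> - \<partial>\<close> and then \<open>\<nu>\<close> by \<open>\<lambda> + \<mu>\<close> composes to the substitution of
  \<open>-\<lambda> - \<mu> - \<partial>\<close>: the second substitution commutes with \<open>\<partial>\<close>, because \<open>\<partial>\<close> acts on the
  coefficients and so commutes with \<open>\<lambda>\<close> and \<open>\<mu>\<close>.\<close>

lemma subst_var_lam_mu_opposite:
  assumes D: "additive D"
  shows "subst_var lam_mu cst2 (opposite D f x c) = subst_var (neg_lam_mu_d D) cst2 (f c x)"
proof -
  let ?E = "subst_var lam_mu cst2 :: 'a poly \<Rightarrow> 'a poly poly"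
  note E = additive_subst_var[OF additive_lam_mu additive_cst2]
  have const: "?E [:y:] = cst2 y" for y
    by (simp add: subst_var_pCons[OF additive_lam_mu additive_cst2] additive.zero[OF E]
        additive.zero[OF additive_lam_mu])
  have "?E (- pCons 0 q - map_poly D q) = neg_lam_mu_d D (?E q)" for q
  proof -
    have "?E (pCons 0 q) = lam_mu (?E q)"
      by (simp add: subst_var_pCons[OF additive_lam_mu additive_cst2] additive.zero[OF additive_cst2])
    then show ?thesis
      by (simp only: additive.diff[OF E] additive.minus[OF E] subst_var_lam_mu_map_poly[OF D]
          neg_lam_mu_d_def[of D "?E q"] lam_mu_def[of "?E q"]) simp
  qed
  from subst_var_intertwine[where E = ?E and T = "\<lambda>q. - pCons 0 q - map_poly D q"
      and T' = "neg_lam_mu_d D" and f = "\<lambda>y. [:y:]" and p = "f c x", OF E this]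
  show ?thesis
    unfolding opposite_def by (simp only: const)
qed

text \<open>This brings \<open>[[a b] c]\<close> into the form \<open>-[c [a b]]\<close> that the Chevalley-Eilenberg
  differential uses.\<close>

lemma left_comp_eq_right_comp_if_skew:
  assumes D: "additive D" and skew: "\<And>a b. f a b = - opposite D f a b"
  shows "left_comp f p lam lam_mu c = - right_comp f c (neg_lam_mu_d D) p lam"
proof -
  have "subst_var lam_mu cst2 (f x c) = - subst_var (neg_lam_mu_d D) cst2 (f c x)" for x
    by (subst skew)
      (simp add: additive.minus[OF additive_subst_var[OF additive_lam_mu additive_cst2]]
        subst_var_lam_mu_opposite[OF D])
  then show ?thesis
    by (simp add: left_comp_def right_comp_def subst_var_def sum_negf
        additive.minus[OF additive_funpow[OF additive_lam]])
qed

section \<open>Linear deformations\<close>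

lemma additive_if_linear:
  assumes "Vector_Spaces.linear s1 s2 f"
  shows "additive f"
proof -
  from assms interpret Vector_Spaces.linear s1 s2 f .
  show ?thesis
    by unfold_locales (rule add)
qed

lemma bilinear_bracket_additive:
  assumes "bilinear_bracket scale f"
  shows "additive (f a)" and "additive (\<lambda>a. f a b)"
  using assms additive_if_linear unfolding bilinear_bracket_def by blast+

context vector_space
begin

lemma double_eq_0_iff: "x + x = 0 \<longleftrightarrow> x = 0" if "(2::'a) \<noteq> 0" for x :: 'b
proof -
  have "scale 2 x = x + x"
    using scale_left_distrib[of 1 1 x] by simp
  with that show ?thesis
    using scale_eq_0_iff[of 2 x] by simp
qed

end

lemma double_poly_poly_eq_0:
  fixes p :: "'a::ab_group_add poly poly"
  assumes "\<And>x::'a. x + x = 0 \<longleftrightarrow> x = 0" and "p + p = 0"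
  shows "p = 0"
proof -
  have "coeff (coeff p i) j + coeff (coeff p i) j = 0" for i j
    using assms(2) by (metis coeff_0 coeff_add)
  then show ?thesis
    by (simp add: assms(1) poly_eq_iff)
qed

lemma deformed_bracket_1:
  assumes "vector_space scale"
  shows "deformed_bracket scale 1 f g = (\<lambda>a b. f a b + g a b)"
  by (intro ext poly_eqI)
    (simp add: deformed_bracket_def coeff_map_poly module.scale_zero_right
      module.scale_one assms[folded module_iff_vector_space])

lemma deformed_bracket_minus_1:
  assumes "vector_space scale"
  shows "deformed_bracket scale (- 1) f g = (\<lambda>a b. f a b - g a b)"
  by (intro ext poly_eqI)
    (simp add: deformed_bracket_def coeff_map_poly module.scale_zero_right module.scale_minus_left
      module.scale_one assms[folded module_iff_vector_space])

lemma lambda_bracket2_of_sum: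
  assumes "lambda_bracket2 scale D f" and "lambda_bracket2 scale D (\<lambda>a b. f a b + g a b)"
    and "bilinear_bracket scale g" and "additive D"
  shows "lambda_bracket2 scale D g"
proof -
  have add: "pCons 0 (p + q) = pCons 0 p + pCons 0 q" for p q :: "'a poly"
    by simp
  show ?thesis
    using assms(1-3) unfolding lambda_bracket2_def
    by (auto simp: add additive.add[OF additive_map_poly[OF assms(4)]] algebra_simps simp del: add_pCons)
qed

theorem proposition5p12:
  fixes scale :: "complex \<Rightarrow> 'a::ab_group_add \<Rightarrow> 'a"
    and D :: "'a \<Rightarrow> 'a"
    and circ brac varpi omega :: "'a bracket2"
  assumes "nc_poisson_conformal_algebra scale D circ brac"
    and "generates_linear_deformation scale D circ brac varpi omega"
  shows "is_2_cocycle_FGV scale D circ brac (omega, varpi)"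
proof -
  interpret P: nc_poisson_conformal_algebra scale D circ brac by fact
  let ?circ1 = "\<lambda>a b. circ a b + varpi a b" and ?brac1 = "\<lambda>a b. brac a b + omega a b"
  let ?circ2 = "\<lambda>a b. circ a b - varpi a b" and ?brac2 = "\<lambda>a b. brac a b - omega a b"
  have bil: "bilinear_bracket scale varpi" "bilinear_bracket scale omega"
    "bilinear_bracket scale circ" "bilinear_bracket scale brac"
    using assms(2) P.circ.bracket P.brac.bracket
    by (auto simp: generates_linear_deformation_def lambda_bracket2_def)
  note add = bil[THEN bilinear_bracket_additive(1)] bil[THEN bilinear_bracket_additive(2)]
  have D: "additive D"
    by (rule additive_if_linear[OF P.circ.D_linear])
  have deformed: "nc_poisson_conformal_algebra scale D
      (deformed_bracket scale t circ varpi) (deformed_bracket scale t brac omega)" for t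
    using assms(2) by (simp add: generates_linear_deformation_def)
  interpret plus: nc_poisson_conformal_algebra scale D ?circ1 ?brac1
    using deformed[of 1] by (simp add: deformed_bracket_1[OF P.circ.vector_space_axioms])
  interpret minus: nc_poisson_conformal_algebra scale D ?circ2 ?brac2
    using deformed[of "- 1"] by (simp add: deformed_bracket_minus_1[OF P.circ.vector_space_axioms])
  \<comment> \<open>Conditions on a single bracket, here and for sesquilinearity, hold for the difference of the
    bracket at \<open>t = 1\<close> and the original one.\<close>
  have omega_skew: "omega a b = - opposite D omega a b" for a b
    using plus.skew[of a b] P.skew[of a b] by (simp add: opposite_add[OF D])
  have "(omega, varpi) \<in> C2_FGV scale D"
    using lambda_bracket2_of_sum[OF P.circ.bracket plus.circ.bracket bil(1) D]
      lambda_bracket2_of_sum[OF P.brac.bracket plus.brac.bracket bil(2) D] omega_skew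
    by (simp add: C2_FGV_def C20_def C02_def)
  moreover have "d02_H circ varpi a b c = 0" for a b c
  proof (rule double_poly_poly_eq_0[OF P.circ.double_eq_0_iff])
    show "d02_H circ varpi a b c + d02_H circ varpi a b c = 0"
      using arg_cong2[OF plus.assoc[of a b c] minus.assoc[of a b c], of "(-)"]
      by (simp add: right_comp_polarization left_comp_polarization additive_variables add
          d02_H_def algebra_simps)
  qed simp
  moreover have "d02_CE brac varpi a b c - d11_H circ omega a b c = 0" (is "?d = 0") for a b c
  proof (rule double_poly_poly_eq_0[OF P.circ.double_eq_0_iff])
    show "?d + ?d = 0"
      using arg_cong2[OF plus.leibniz[of a b c] minus.leibniz[of a b c], of "(-)"]
      \<comment> \<open>The right-hand sides are sums; regrouping their difference termwise pairs each iterated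
        bracket at \<open>t = 1\<close> with the same one at \<open>t = -1\<close>, as polarization needs.\<close>
      unfolding add_diff_add
      by (simp add: right_comp_polarization left_comp_polarization additive_variables add
          d02_CE_def d11_H_def algebra_simps)
  qed simp
  moreover have "d_CE D brac omega a b c = 0" for a b c
  proof (rule double_poly_poly_eq_0[OF P.circ.double_eq_0_iff])
    note flip = left_comp_eq_right_comp_if_skew[OF D P.skew]
      left_comp_eq_right_comp_if_skew[OF D omega_skew]
    show "d_CE D brac omega a b c + d_CE D brac omega a b c = 0"
      using arg_cong2[OF plus.jacobi[of a b c] minus.jacobi[of a b c], of "(-)"]
      unfolding add_diff_add
      by (simp add: right_comp_polarization left_comp_polarization additive_variables add flip
          d_CE_def algebra_simps)
  qed simp
  ultimately show ?thesis
    by (simp add: is_2_cocycle_FGV_def d_FGV_def fun_eq_iff)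
qed

end
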